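(* Let $d\ge 1$ be an integer and let $(d_{k,l})_{k,l\in\mathbb{N}}$ be a double sequence of finite constants. (i) For all $q>1$, $0<\epsilon<1$ and $p\ge 1$ there is a constant $C$, depending only on the double sequence $(d_{k,l})$ and on $p,q,d,\epsilon$, such that the following holds. Let $\xi,\eta$ be any $\mathbb{R}^d$-valued random variables having density functions $f_\xi,f_\eta$ with respect to the $d$-dimensional Lebesgue measure, with $f_\xi,f_\eta\in C^\infty$ and $$\big\Vert f^{(k)}_{\xi}(x)(1+|x|)^{l}\big\Vert_{\infty}+\big\Vert f^{(k)}_{\eta}(x)(1+|x|)^{l}\big\Vert_{\infty}\le d_{k,l}\qquad\text{for all }k,l\in\mathbb{N}.$$ Then $$\rho_{p}(\mathcal{L}(\xi),\mathcal{L}(\eta))\le C\,W_{q}(\mathcal{L}(\xi),\mathcal{L}(\eta))^{1-\epsilon}.$$ (ii) Furthermore, for all $q>1$, $0<\epsilon<1$, $p\ge 1$ and every multiindex $\alpha\in\mathbb{N}^d$ there is a constant $C'$, depending only on the double sequence $(d_{k,l})$ and on $p,q,d,|\alpha|,\epsilon$, such that for all $\xi,\eta$ satisfying the same assumptions as in (i), $$\big\Vert(\partial_{\alpha}f_{\xi}(x)-\partial_{\alpha}f_{\eta}(x))(1+|x|^{p})\big\Vert_{\infty}\le C'\,W_{q}(\mathcal{L}(\xi),\mathcal{L}(\eta))^{1-\epsilon}.$$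
   Context: $\mathbb{N}$ includes $0$. $|\cdot|$ is the Euclidean norm on $\mathbb{R}^k$ or $\mathbb{C}^k$; for a multiindex $\alpha=(\alpha_1,\dots,\alpha_d)\in\mathbb{N}^d$, $|\alpha|=\sum_j\alpha_j$ and $\partial_\alpha$ is the corresponding partial derivative. $\mathcal{L}(X)$ is the law of the random variable $X$. $C^\infty$ is the set of infinitely many times differentiable functions $\mathbb{R}^d\to\mathbb{C}$. For $g\in C^\infty$, $g^{(l)}:\mathbb{R}^d\to\mathbb{C}^{d^l}$ is the $l$-th derivative of $g$ (the array of all $l$-th order partial derivatives), with $g^{(0)}=g$. For $g:\mathbb{R}^d\to\mathbb{C}^k$, $\Vert g\Vert_\infty=\sup_{x\in\mathbb{R}^d}|g(x)|$; the notation $\Vert g(x)(1+|x|)^l\Vert_\infty$ means the supremum over $x\in\mathbb{R}^d$ of $|g(x)|(1+|x|)^l$. For Borel probability measures $\mu,\nu$ on $\mathbb{R}^d$ and $p\ge 1$, the weighted total variation distance is $$\rho_p(\mu,\nu)=\int_{\mathbb{R}^d}(1+|x|^p)\,|||\mu-\nu|||(dx),$$ where $|||\mu-\nu|||$ is the total variation measure of the signed measure $\mu-\nu$. For $q\ge1$ the $q$-Wasserstein distance is $$W_q(\mu,\nu)=\Big(\inf_{\pi\in\mathcal{C}(\mu,\nu)}\int_{\mathbb{R}^d}\int_{\mathbb{R}^d}|x-y|^q\,\pi(dx,dy)\Big)^{1/q},$$ where $\mathcal{C}(\mu,\nu)$ is the set of probability measures on $\mathbb{R}^d\times\mathbb{R}^d$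 with marginals $\mu$ and $\nu$. *)

theory Defs
  imports "HOL-Probability.Probability"
begin

definition partial_deriv :: "'n::finite \<Rightarrow> (real ^ 'n \<Rightarrow> 'b::real_normed_vector) \<Rightarrow> real ^ 'n \<Rightarrow> 'b" where
  "partial_deriv i g x = vector_derivative (\<lambda>t. g (x + t *\<^sub>R axis i 1)) (at 0)"

definition iter_partial :: "'n::finite list \<Rightarrow> (real ^ 'n \<Rightarrow> 'b::real_normed_vector) \<Rightarrow> real ^ 'n \<Rightarrow> 'b" where
  "iter_partial js g = foldr partial_deriv js g"

text \<open>\<open>differentiable\<close> is Frechet differentiability. A function is infinitely often
  differentiable iff it is differentiable and all its first-order partial derivatives are
  infinitely often differentiable; unrolled, this is the following condition (the empty list
  gives \<open>g\<close> itself).\<close>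

definition smooth :: "(real ^ 'n::finite \<Rightarrow> 'b::real_normed_vector) \<Rightarrow> bool" where
  "smooth g \<longleftrightarrow> (\<forall>js x. iter_partial js g differentiable (at x))"

text \<open>A multiindex is a function \<open>\<alpha> :: 'n \<Rightarrow> nat\<close>. The index type carries no order, so some
  list in which every coordinate \<open>i\<close> occurs \<open>\<alpha> i\<close> times is chosen; for smooth functions the
  order of differentiation does not matter.\<close>

definition multi_partial :: "('n::finite \<Rightarrow> nat) \<Rightarrow> (real ^ 'n \<Rightarrow> 'b::real_normed_vector) \<Rightarrow> real ^ 'n \<Rightarrow> 'b" where
  "multi_partial \<alpha> = iter_partial (SOME js. \<forall>i. count_list js i = \<alpha> i)"

text \<open>\<open>|g\<^sup>(\<^sup>l\<^sup>)(x)|\<close>, the Euclidean norm of the array of all \<open>d\<^sup>l\<close> partial derivatives of order \<open>l\<close>;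
  the lists of length \<open>l\<close> are the positions in this array.\<close>

definition deriv_norm :: "nat \<Rightarrow> (real ^ 'n::finite \<Rightarrow> 'b::real_normed_vector) \<Rightarrow> real ^ 'n \<Rightarrow> real" where
  "deriv_norm l g x = L2_set (\<lambda>js. norm (iter_partial js g x)) {js. length js = l}"

definition sup_norm :: "('a \<Rightarrow> 'b::real_normed_vector) \<Rightarrow> ennreal" where
  "sup_norm g = (SUP x. ennreal (norm (g x)))"

text \<open>The total variation measure of the signed measure \<open>\<mu> - \<nu>\<close>, for finite measures
  \<open>\<mu>\<close> and \<open>\<nu>\<close> on the same \<open>\<sigma>\<close>-algebra.\<close>

definition tv_measure :: "'a measure \<Rightarrow> 'a measure \<Rightarrow> 'a measure" where
  "tv_measure \<mu> \<nu> = measure_of (space \<mu>) (sets \<mu>)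
     (\<lambda>A. SUP P \<in> {P. finite P \<and> P \<subseteq> sets \<mu> \<and> partition_on A P}.
            \<Sum>B\<in>P. ennreal \<bar>measure \<mu> B - measure \<nu> B\<bar>)"

definition weighted_tv :: "real \<Rightarrow> 'a::euclidean_space measure \<Rightarrow> 'a measure \<Rightarrow> ennreal" where
  "weighted_tv p \<mu> \<nu> = (\<integral>\<^sup>+x. ennreal (1 + norm x powr p) \<partial>tv_measure \<mu> \<nu>)"

definition couplings :: "'a::euclidean_space measure \<Rightarrow> 'a measure \<Rightarrow> ('a \<times> 'a) measure set" where
  "couplings \<mu> \<nu> = {\<pi>. prob_space \<pi> \<and> sets \<pi> = sets (borel \<Otimes>\<^sub>M borel) \<and>
     distr \<pi> borel fst = \<mu> \<and> distr \<pi> borel snd = \<nu>}"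

text \<open>Powers of extended nonnegative reals; only meant for exponents \<open>a > 0\<close>.\<close>

definition ennpowr :: "ennreal \<Rightarrow> real \<Rightarrow> ennreal" where
  "ennpowr x a = (if x = \<infinity> then \<infinity> else ennreal (enn2real x powr a))"

definition wasserstein :: "real \<Rightarrow> 'a::euclidean_space measure \<Rightarrow> 'a measure \<Rightarrow> ennreal" where
  "wasserstein q \<mu> \<nu> =
     ennpowr (INF \<pi>\<in>couplings \<mu> \<nu>. \<integral>\<^sup>+z. ennreal (norm (fst z - snd z) powr q) \<partial>\<pi>) (1 / q)"

definition law_with_density :: "(real ^ 'n::finite) measure \<Rightarrow> (real ^ 'n \<Rightarrow> real) \<Rightarrow> bool" where
  "law_with_density \<mu> f \<longleftrightarrow> prob_space \<mu> \<and> (\<forall>x. 0 \<le> f x) \<and> f \<in> borel_measurable borel \<and>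
     \<mu> = density lborel (\<lambda>x. ennreal (f x))"

text \<open>The pairs of laws are quantified over, rather than random variables: a constant quantified
  before all random variables may depend on the type of their sample spaces in HOL, whereas it
  must not depend on it here. The next two lemmas say that these laws are exactly those of
  random variables with density \<open>f\<close>.\<close>

lemma law_with_density_random_variable:
  assumes "prob_space M" "distributed M lborel \<xi> (\<lambda>x. ennreal (f x))"
    "\<And>x. 0 \<le> f x" "f \<in> borel_measurable borel"
  shows "law_with_density (distr M borel \<xi>) f"
proof -
  have X: "\<xi> \<in> measurable M borel"
    using assms(2) by (simp add: distributed_def)
  have "distr M borel \<xi> = distr M lborel \<xi>"
    by (rule distr_cong) auto
  also have "\<dots> = density lborel (\<lambda>x. ennreal (f x))"
    using assms(2) by (simp add: distributed_def)
  finally show ?thesis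
    using assms(3,4) prob_space.prob_space_distr[OF assms(1) X]
    by (simp add: law_with_density_def)
qed

lemma law_with_density_identity:
  assumes "law_with_density \<mu> f"
  shows "distributed \<mu> lborel (\<lambda>x. x) (\<lambda>x. ennreal (f x))"
    and "distr \<mu> borel (\<lambda>x. x) = \<mu>"
proof -
  have s: "sets \<mu> = sets borel"
    using assms by (simp add: law_with_density_def)
  show "distr \<mu> borel (\<lambda>x. x) = \<mu>"
    using s by (intro distr_id2) simp
  moreover have "distr \<mu> lborel (\<lambda>x. x) = distr \<mu> borel (\<lambda>x. x)"
    by (rule distr_cong) auto
  ultimately show "distributed \<mu> lborel (\<lambda>x. x) (\<lambda>x. ennreal (f x))"
    using assms s by (auto simp: law_with_density_def distributed_def)
qed

text \<open>\<open>ennreal\<close> sends a negative \<open>D k l\<close> to 0; this admits no further pairs, since no density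
  or derivative of an integrable density vanishes identically.\<close>

definition admissible ::
  "(nat \<Rightarrow> nat \<Rightarrow> real) \<Rightarrow> (real ^ 'n::finite) measure \<Rightarrow> (real ^ 'n \<Rightarrow> real) \<Rightarrow>
    (real ^ 'n) measure \<Rightarrow> (real ^ 'n \<Rightarrow> real) \<Rightarrow> bool" where
  "admissible D \<mu> f \<nu> g \<longleftrightarrow>
     law_with_density \<mu> f \<and> law_with_density \<nu> g \<and> smooth f \<and> smooth g \<and>
     (\<forall>k l. sup_norm (\<lambda>x. deriv_norm k f x * (1 + norm x) ^ l)
          + sup_norm (\<lambda>x. deriv_norm k g x * (1 + norm x) ^ l) \<le> ennreal (D k l))"

end

theory Submission
  imports Defs
begin

text \<open>
  Let \<open>h\<close> be the difference of the densities, \<open>W\<close> the Wasserstein distance and \<open>a k\<close> the supremum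
  of the partial derivatives of \<open>h\<close> of order \<open>k\<close>. Integrating \<open>h\<close> against a tent function of radius
  \<open>r\<close> bounds \<open>a 0\<close> by \<open>a 1 * r + W / r ^ (d + 1)\<close> up to a constant, and Taylor expansion along the
  axes gives Landau's inequality \<open>a (k + 1) \<le> 2 * a k / t + t * a (k + 2)\<close>. Let \<open>s k\<close> be the supremum
  of the exponents \<open>\<theta> \<le> 1\<close> such that \<open>a k\<close> is at most a constant times \<open>W powr \<theta>\<close>, uniformly over all
  admissible pairs. Landau's inequality makes \<open>s\<close> concave; being bounded it is nondecreasing. The
  tent estimate with optimal \<open>r\<close> gives \<open>s 1 + (1 - s 1) / (d + 2) \<le> s 0 \<le> s 1\<close>, so \<open>s\<close> is constantly 1.
  Polynomial weights cost an arbitrarily small part of the exponent, by interpolation with the assumed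
  bounds for larger weights. The bound on the weighted total variation distance is the case of
  order 0, as the weight may be raised to make the integral over the space converge.
\<close>

section \<open>Exponents of sequences obeying Landau's inequality\<close>

text \<open>Here \<open>a\<close> stands for the sequence of suprema of derivatives and
  \<open>w\<close> for a number above the Wasserstein distance. Arguing with the whole set
  \<open>S\<close> rather than with one sequence makes every constant \<open>K\<close> uniform over
  the pairs of laws.\<close>

lemma landau_sequence_powr_bound:
  fixes S :: "((nat \<Rightarrow> real) \<times> real) set"
  assumes w: "\<And>a w. (a, w) \<in> S \<Longrightarrow> 0 < w \<and> w \<le> 1"
    and bnd: "\<And>a w k. (a, w) \<in> S \<Longrightarrow> a k \<le> B k"
    and K0: "0 \<le> K0"
    and base: "\<And>a w r. (a, w) \<in> S \<Longrightarrow> 0 < r \<Longrightarrow> a 0 \<le> K0 * (a 1 * r + w / r ^ m)"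
    and landau: "\<And>a w k t. (a, w) \<in> S \<Longrightarrow> 0 < t \<Longrightarrow>
      a (Suc k) \<le> 2 * a k / t + t * a (Suc (Suc k))"
    and \<theta>: "\<theta> < 1"
  shows "\<exists>K\<ge>0. \<forall>(a, w)\<in>S. a k \<le> K * w powr \<theta>"
proof -
  define T where "T k = {\<theta>. 0 \<le> \<theta> \<and> \<theta> \<le> 1 \<and> (\<exists>K\<ge>0. \<forall>(a, w)\<in>S. a k \<le> K * w powr \<theta>)}" for k
  \<comment> \<open>The bound \<open>B k\<close> does not involve \<open>w\<close>, so exponent 0 is
    always available.\<close>
  have T0: "0 \<in> T k" for k
    unfolding T_def using w bnd[of _ _ k]
    by (fastforce intro!: exI[of _ "max 0 (B k)"])
  have T01: "\<theta> \<in> T k \<Longrightarrow> 0 \<le> \<theta> \<and> \<theta> \<le> 1" for \<theta> k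
    by (auto simp: T_def)
  have TD: "\<exists>K\<ge>0. \<forall>a w. (a, w) \<in> S \<longrightarrow> a k \<le> K * w powr \<theta>" if "\<theta> \<in> T k" for \<theta> k
    using that by (auto simp: T_def)
  have bdd: "bdd_above (T k)" for k
    by (rule bdd_aboveI[of _ 1]) (use T01 in blast)
  define s where "s k = Sup (T k)" for k
  have s_ge: "\<theta> \<le> s k" if "\<theta> \<in> T k" for \<theta> k
    unfolding s_def by (rule cSup_upper[OF that bdd])
  have s0: "0 \<le> s k" for k using s_ge[OF T0] .
  have s1: "s k \<le> 1" for k
    unfolding s_def by (rule cSup_least) (use T0 T01 in blast)+
  have below: "\<exists>\<theta>\<in>T k. x < \<theta>" if "x < s k" for x k
    using less_cSup_iff[OF _ bdd, of k x] T0[of k] that unfolding s_def by blast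
  have landau_T: "(\<theta> + \<theta>') / 2 \<in> T (Suc k)" if \<theta>: "\<theta> \<in> T k" "\<theta>' \<in> T (Suc (Suc k))" for \<theta> \<theta>' k
  proof -
    obtain K where K: "K \<ge> 0" "\<And>a w. (a, w) \<in> S \<Longrightarrow> a k \<le> K * w powr \<theta>"
      using TD[OF \<theta>(1)] by blast
    obtain K' where K': "K' \<ge> 0" "\<And>a w. (a, w) \<in> S \<Longrightarrow> a (Suc (Suc k)) \<le> K' * w powr \<theta>'"
      using TD[OF \<theta>(2)] by blast
    have "a (Suc k) \<le> (2 * K + K') * w powr ((\<theta> + \<theta>') / 2)" if S: "(a, w) \<in> S" for a w
    proof -
      have w0: "0 < w" using w[OF S] by simp
      \<comment> \<open>Balances Landau's inequality: both terms acquire the mean exponent.\<close>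
      define t where "t = w powr ((\<theta> - \<theta>') / 2)"
      have t: "0 < t" using w0 by (simp add: t_def)
      have "a (Suc k) \<le> 2 * a k / t + t * a (Suc (Suc k))" by (rule landau[OF S t])
      also have "\<dots> \<le> 2 * (K * w powr \<theta>) / t + t * (K' * w powr \<theta>')"
        using t K(2)[OF S] K'(2)[OF S]
        by (intro add_mono divide_right_mono mult_left_mono) auto
      also have "\<dots> = 2 * K * (w powr \<theta> / t) + K' * (t * w powr \<theta>')"
        by (simp add: mult_ac)
      also have "w powr \<theta> / t = w powr ((\<theta> + \<theta>') / 2)"
        unfolding t_def powr_diff[symmetric] by (rule arg_cong[where f = "\<lambda>z. w powr z"]) (simp add: field_simps)
      also have "t * w powr \<theta>' = w powr ((\<theta> + \<theta>') / 2)"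
        unfolding t_def powr_add[symmetric] by (rule arg_cong[where f = "\<lambda>z. w powr z"]) (simp add: field_simps)
      finally show ?thesis by (simp add: algebra_simps)
    qed
    then show ?thesis
      unfolding T_def using T01[OF \<theta>(1)] T01[OF \<theta>(2)] K(1) K'(1)
      by (auto intro!: exI[of _ "2 * K + K'"])
  qed
  have base_T: "\<theta> + (1 - \<theta>) / (m + 1) \<in> T 0" if \<theta>: "\<theta> \<in> T 1" for \<theta>
  proof -
    obtain K where K: "K \<ge> 0" "\<And>a w. (a, w) \<in> S \<Longrightarrow> a 1 \<le> K * w powr \<theta>"
      using TD[OF \<theta>] by blast
    have "a 0 \<le> K0 * (K + 1) * w powr (\<theta> + (1 - \<theta>) / (m + 1))" if S: "(a, w) \<in> S" for a w
    proof -
      have w0: "0 < w" using w[OF S] by simp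
      \<comment> \<open>Solves \<open>w powr \<theta> * r = w / r ^ m\<close>.\<close>
      define r where "r = w powr ((1 - \<theta>) / (m + 1))"
      have r: "0 < r" using w0 by (simp add: r_def)
      have "a 0 \<le> K0 * (a 1 * r + w / r ^ m)" by (rule base[OF S r])
      also have "\<dots> \<le> K0 * (K * w powr \<theta> * r + w / r ^ m)"
        using r K(2)[OF S] K0 by (intro mult_left_mono add_mono mult_right_mono) auto
      also have "K * w powr \<theta> * r = K * w powr (\<theta> + (1 - \<theta>) / (m + 1))"
        by (simp add: r_def powr_add)
      also have "r ^ m = w powr ((1 - \<theta>) / (m + 1) * m)"
        using w0 by (simp add: r_def powr_powr flip: powr_realpow)
      also have "w / \<dots> = w powr (1 - (1 - \<theta>) / (m + 1) * m)"
        using w0 by (simp add: powr_diff)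
      also have "1 - (1 - \<theta>) / (m + 1) * m = \<theta> + (1 - \<theta>) / (m + 1)"
        by (simp add: field_simps)
      finally show ?thesis by (simp add: algebra_simps)
    qed
    \<comment> \<open>Membership in \<open>T 0\<close> requires that the improved exponent stays at
      most 1.\<close>
    moreover have "\<theta> + (1 - \<theta>) / (m + 1) \<le> \<theta> + (1 - \<theta>) / 1"
      using T01[OF \<theta>] by (intro add_left_mono divide_left_mono) auto
    ultimately show ?thesis
      unfolding T_def using T01[OF \<theta>] K(1) K0
      by (auto intro!: exI[of _ "K0 * (K + 1)"])
  qed
  have concave: "s k + s (Suc (Suc k)) \<le> 2 * s (Suc k)" for k
  proof (rule ccontr)
    assume c: "\<not> ?thesis"
    \<comment> \<open>With this gap, exponents within \<open>e\<close> of the two outer suprema have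
      a mean exceeding \<open>s (Suc k)\<close>.\<close>
    define e where "e = (s k + s (Suc (Suc k)) - 2 * s (Suc k)) / 2"
    have e: "0 < e" using c by (simp add: e_def)
    obtain x where x: "x \<in> T k" "s k - e < x" using below[of "s k - e" k] e by auto
    obtain y where y: "y \<in> T (Suc (Suc k))" "s (Suc (Suc k)) - e < y"
      using below[of "s (Suc (Suc k)) - e" "Suc (Suc k)"] e by auto
    have "(x + y) / 2 \<le> s (Suc k)" by (rule s_ge[OF landau_T[OF x(1) y(1)]])
    with x(2) y(2) show False by (simp add: e_def field_simps)
  qed
  have s01: "s 1 + (1 - s 1) / (m + 1) \<le> s 0"
  proof (rule field_le_epsilon)
    fix e :: real assume e: "0 < e"
    \<comment> \<open>The supremum need not be attained, so \<open>base_T\<close> is applied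
      slightly below \<open>s 1\<close>.\<close>
    obtain x where x: "x \<in> T 1" "s 1 - e < x" using below[of "s 1 - e" 1] e by auto
    have "s 1 + (1 - s 1) / (m + 1) \<le> x + e + (1 - x) / (m + 1)"
      using x(2) s_ge[OF x(1)] by (intro add_mono divide_right_mono) auto
    with s_ge[OF base_T[OF x(1)]] show "s 1 + (1 - s 1) / (m + 1) \<le> s 0 + e" by simp
  qed
  \<comment> \<open>By concavity the drops never shrink, so a single drop would eventually push
    \<open>s\<close> below 0.\<close>
  have mono: "s k \<le> s (Suc k)" for k
  proof (rule ccontr)
    assume "\<not> ?thesis"
    then have c: "0 < s k - s (Suc k)" by simp
    have step: "s (k + n) - s (Suc (k + n)) \<ge> s k - s (Suc k)" for n
    proof (induction n)
      case (Suc n) then show ?case using concave[of "k + n"] by simp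
    qed simp
    have lin: "s (k + n) \<le> s k - n * (s k - s (Suc k))" for n
    proof (induction n)
      case (Suc n) then show ?case using step[of n] by (simp add: algebra_simps)
    qed simp
    obtain n :: nat where "s k < n * (s k - s (Suc k))" using reals_Archimedean3[OF c] by blast
    with lin[of n] s0[of "k + n"] show False by simp
  qed
  \<comment> \<open>Since \<open>s 0\<close> is at most \<open>s 1\<close>, the gain in
    \<open>s01\<close> must vanish.\<close>
  have "(1 - s 1) / (m + 1) \<le> 0" using s01 mono[of 0] by simp
  then have "1 \<le> s 1" by (simp add: divide_le_0_iff)
  then have "1 \<le> s 0" using s01 s1[of 1] by simp
  then have "1 \<le> s k" using lift_Suc_mono_le[of s 0 k] mono by force
  then obtain y where y: "y \<in> T k" "\<theta> < y" using below[of \<theta> k] \<theta> by auto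
  then obtain K where K: "K \<ge> 0" "\<And>a w. (a, w) \<in> S \<Longrightarrow> a k \<le> K * w powr y"
    using TD by blast
  have "a k \<le> K * w powr \<theta>" if "(a, w) \<in> S" for a w
  proof -
    have "w powr y \<le> w powr \<theta>" using w[OF that] y(2) by (intro powr_mono') auto
    with K(2)[OF that] K(1) show ?thesis by (meson mult_left_mono order_trans)
  qed
  with K(1) show ?thesis by auto
qed

section \<open>Lipschitz test functions and the Wasserstein distance\<close>

text \<open>This is the easy direction of Kantorovich duality. The strict inequality provides a
  coupling of cost below \<open>w powr q\<close>, and the difference of the integrals is the
  integral of \<open>\<phi> (fst z) - \<phi> (snd z)\<close> against it. Boundedness of
  \<open>\<phi>\<close> provides the integrability.\<close>

lemma wasserstein_lipschitz_bound:
  fixes \<phi> :: "'a::euclidean_space \<Rightarrow> real"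
  assumes sets: "sets \<mu> = sets borel" "sets \<nu> = sets borel"
    and q: "1 < q" and w: "wasserstein q \<mu> \<nu> < ennreal w"
    and lip: "\<And>x y. \<bar>\<phi> x - \<phi> y\<bar> \<le> L * norm (x - y)" and L: "0 \<le> L"
    and bounded: "\<And>x. \<bar>\<phi> x\<bar> \<le> B"
  shows "\<bar>(\<integral>x. \<phi> x \<partial>\<mu>) - (\<integral>x. \<phi> x \<partial>\<nu>)\<bar> \<le> 2 * L * w"
proof -
  define I where "I = (INF \<pi>\<in>couplings \<mu> \<nu>. \<integral>\<^sup>+z. ennreal (norm (fst z - snd z) powr q) \<partial>\<pi>)"
  have w0: "0 < w" using w by (metis ennreal_less_zero_iff le_less_trans zero_le)
  have "ennpowr I (1 / q) < ennreal w" using w by (simp add: wasserstein_def I_def)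
  \<comment> \<open>Finiteness is recorded first because \<open>enn2real\<close> sends infinity to
    0.\<close>
  then have fin: "I \<noteq> \<infinity>" and "enn2real I powr (1 / q) < w"
    by (auto simp: ennpowr_def ennreal_less_iff split: if_splits)
  then have "(enn2real I powr (1 / q)) powr q < w powr q"
    using q by (intro powr_less_mono2) auto
  then have "enn2real I < w powr q" using q by (simp add: powr_powr)
  then have "I < ennreal (w powr q)"
    using fin by (metis enn2real_nonneg ennreal_enn2real ennreal_less_iff infinity_ennreal_def less_top)
  then obtain \<pi> where \<pi>: "\<pi> \<in> couplings \<mu> \<nu>"
    and cost: "(\<integral>\<^sup>+z. ennreal (norm (fst z - snd z) powr q) \<partial>\<pi>) < ennreal (w powr q)"
    unfolding I_def Inf_less_iff by blast
  interpret prob_space \<pi> using \<pi> by (simp add: couplings_def)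
  have sets_\<pi>[measurable_cong]: "sets \<pi> = sets (borel \<Otimes>\<^sub>M borel)"
    and marg: "\<mu> = distr \<pi> borel fst" "\<nu> = distr \<pi> borel snd"
    using \<pi> by (simp_all add: couplings_def)
  have "L-lipschitz_on UNIV \<phi>"
    using lip L by (auto intro!: lipschitz_onI simp: dist_norm)
  then have \<phi>[measurable]: "\<phi> \<in> borel_measurable borel"
    by (intro borel_measurable_continuous_onI lipschitz_on_continuous_on)
  have int: "integrable \<pi> (\<lambda>z. \<phi> (fst z))" "integrable \<pi> (\<lambda>z. \<phi> (snd z))"
    using bounded by (auto intro!: integrable_const_bound[where B = B])
  have "(\<integral>x. \<phi> x \<partial>\<mu>) - (\<integral>x. \<phi> x \<partial>\<nu>) = (\<integral>z. \<phi> (fst z) - \<phi> (snd z) \<partial>\<pi>)"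
    unfolding marg using int by (subst (1 2) integral_distr) auto
  then have "ennreal \<bar>(\<integral>x. \<phi> x \<partial>\<mu>) - (\<integral>x. \<phi> x \<partial>\<nu>)\<bar> \<le> (\<integral>\<^sup>+z. ennreal \<bar>\<phi> (fst z) - \<phi> (snd z)\<bar> \<partial>\<pi>)"
    using integral_norm_bound_ennreal[of \<pi> "\<lambda>z. \<phi> (fst z) - \<phi> (snd z)"] int by simp
  also have "\<dots> \<le> (\<integral>\<^sup>+z. ennreal (L * w) + ennreal (L * w powr (1 - q)) * ennreal (norm (fst z - snd z) powr q) \<partial>\<pi>)"
  proof (intro nn_integral_mono)
    fix z :: "'a \<times> 'a"
    let ?n = "norm (fst z - snd z)"
    \<comment> \<open>Replaces Jensen's inequality: a bound of \<open>?n\<close> linear in \<open>?n powr q\<close>.\<close>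
    have "?n \<le> w + w powr (1 - q) * ?n powr q"
    proof (cases "?n \<le> w")
      case False
      then have n: "w < ?n" by simp
      have "?n = ?n powr (1 - q) * ?n powr q"
        using n w0 by (simp flip: powr_add)
      also have "\<dots> \<le> w powr (1 - q) * ?n powr q"
        using n w0 q by (intro mult_right_mono powr_mono2') auto
      finally show ?thesis using w0 by simp
    qed (simp add: add_increasing2)
    then have "L * ?n \<le> L * (w + w powr (1 - q) * ?n powr q)"
      using L by (rule mult_left_mono)
    then have "\<bar>\<phi> (fst z) - \<phi> (snd z)\<bar> \<le> L * w + L * w powr (1 - q) * ?n powr q"
      using lip[of "fst z" "snd z"] by (simp add: algebra_simps)
    then show "ennreal \<bar>\<phi> (fst z) - \<phi> (snd z)\<bar> \<le> ennreal (L * w) + ennreal (L * w powr (1 - q)) * ennreal (?n powr q)"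
      using L w0 by (simp add: ennreal_leI flip: ennreal_plus ennreal_mult)
  qed
  also have "\<dots> = ennreal (L * w) + ennreal (L * w powr (1 - q)) * (\<integral>\<^sup>+z. ennreal (norm (fst z - snd z) powr q) \<partial>\<pi>)"
    by (subst nn_integral_add) (auto simp: nn_integral_cmult emeasure_space_1)
  also have "\<dots> \<le> ennreal (L * w) + ennreal (L * w powr (1 - q)) * ennreal (w powr q)"
    using cost by (intro add_mono mult_left_mono) auto
  also have "\<dots> = ennreal (L * w + L * (w powr (1 - q) * w powr q))"
    using L w0 by (simp add: mult.assoc flip: ennreal_plus ennreal_mult)
  \<comment> \<open>Both terms of the linear bound contribute \<open>L * w\<close>, whence the
    factor 2.\<close>
  also have "L * w + L * (w powr (1 - q) * w powr q) = 2 * L * w"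
    using w0 by (simp flip: powr_add)
  finally show ?thesis using L w0 by (simp add: ennreal_le_iff)
qed

section \<open>Partial derivatives along the coordinate axes\<close>

lemma partial_deriv_eq_derivative:
  assumes "(g has_derivative g') (at x)"
  shows "partial_deriv i g x = g' (axis i 1)"
proof -
  have g: "(g has_derivative g') (at (x + 0 *\<^sub>R axis i 1))" using assms by simp
  have "((\<lambda>t. g (x + t *\<^sub>R axis i 1)) has_derivative (\<lambda>t. g' (t *\<^sub>R axis i 1))) (at 0)"
    by (rule has_derivative_compose[where f = "\<lambda>t. x + t *\<^sub>R axis i 1", OF _ g]) (auto intro!: derivative_eq_intros)
  moreover have "g' (t *\<^sub>R axis i 1) = t *\<^sub>R g' (axis i 1)" for t
    using has_derivative_linear[OF assms] by (rule linear_scale)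
  ultimately show ?thesis
    unfolding partial_deriv_def has_vector_derivative_def[symmetric]
    by (simp add: vector_derivative_at has_vector_derivative_def)
qed

lemma iter_partial_Cons: "iter_partial (i # js) g = partial_deriv i (iter_partial js g)"
  by (simp add: iter_partial_def)

lemma iter_partial_Nil: "iter_partial [] g = g"
  by (simp add: iter_partial_def)

lemma iter_partial_diff:
  assumes "smooth f" "smooth g"
  shows "iter_partial js (\<lambda>x. f x - g x) = (\<lambda>x. iter_partial js f x - iter_partial js g x)"
proof (induction js)
  case (Cons i js)
  show ?case
  proof
    fix x
    obtain f' g' where f': "(iter_partial js f has_derivative f') (at x)"
      and g': "(iter_partial js g has_derivative g') (at x)"
      using assms unfolding smooth_def differentiable_def by blast
    show "iter_partial (i # js) (\<lambda>x. f x - g x) x = iter_partial (i # js) f x - iter_partial (i # js) g x"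
      unfolding iter_partial_Cons Cons
        partial_deriv_eq_derivative[OF has_derivative_diff[OF f' g']]
        partial_deriv_eq_derivative[OF f'] partial_deriv_eq_derivative[OF g'] ..
  qed
qed (simp add: iter_partial_Nil)

lemma smooth_diff: "smooth f \<Longrightarrow> smooth g \<Longrightarrow> smooth (\<lambda>x. f x - g x)"
  by (subst smooth_def) (auto simp: iter_partial_diff smooth_def)

text \<open>Reduces partial derivatives to functions of one real variable, to which the mean value
  theorem applies. The new index is the head of the list because \<open>iter_partial\<close> applies
  the head last.\<close>

lemma smooth_DERIV_line:
  fixes h :: "real ^ 'n::finite \<Rightarrow> real"
  assumes "smooth h"
  shows "((\<lambda>t. iter_partial js h (x + t *\<^sub>R axis i 1)) has_real_derivative
    iter_partial (i # js) h (x + t *\<^sub>R axis i 1)) (at t)"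
proof -
  obtain h' where h': "(iter_partial js h has_derivative h') (at (x + t *\<^sub>R axis i 1))"
    using assms unfolding smooth_def differentiable_def by blast
  have "((\<lambda>t. iter_partial js h (x + t *\<^sub>R axis i 1)) has_derivative (\<lambda>s. h' (s *\<^sub>R axis i 1))) (at t)"
    by (rule has_derivative_compose[where f = "\<lambda>t. x + t *\<^sub>R axis i 1", OF _ h']) (auto intro!: derivative_eq_intros)
  moreover have "h' (s *\<^sub>R axis i 1) = iter_partial (i # js) h (x + t *\<^sub>R axis i 1) * s" for s
    using linear_scale[OF has_derivative_linear[OF h'], of s]
    by (simp add: iter_partial_Cons partial_deriv_eq_derivative[OF h'])
  ultimately show ?thesis by (simp add: has_field_derivative_def)
qed

text \<open>The difference quotient over length \<open>t\<close> along axis \<open>i\<close> is a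
  value of the first derivative at some intermediate \<open>z\<close>; a second mean value step from
  \<open>z\<close> back to 0 costs at most \<open>t * C\<close>.\<close>

lemma smooth_landau:
  fixes h :: "real ^ 'n::finite \<Rightarrow> real"
  assumes h: "smooth h" and t: "0 < t"
    and A: "\<And>x. \<bar>iter_partial js h x\<bar> \<le> A"
    and C: "\<And>x. \<bar>iter_partial (i # i # js) h x\<bar> \<le> C"
  shows "\<bar>iter_partial (i # js) h x\<bar> \<le> 2 * A / t + t * C"
proof -
  define u where "u s = iter_partial js h (x + s *\<^sub>R axis i 1)" for s
  define v where "v s = iter_partial (i # js) h (x + s *\<^sub>R axis i 1)" for s
  define v' where "v' s = iter_partial (i # i # js) h (x + s *\<^sub>R axis i 1)" for s
  obtain z where z: "0 < z" "z < t" "u t - u 0 = (t - 0) * v z"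
    using MVT2[OF t, of u v] smooth_DERIV_line[OF h, of js x i] unfolding u_def v_def by blast
  obtain z' where z': "v z - v 0 = (z - 0) * v' z'"
    using MVT2[OF z(1), of v v'] smooth_DERIV_line[OF h, of "i # js" x i] unfolding v_def v'_def by blast
  have C0: "0 \<le> C" using C[of x] by linarith
  have "t * v 0 = u t - u 0 - t * (z * v' z')" using z(3) z' by (simp add: algebra_simps)
  then have "\<bar>t * v 0\<bar> \<le> \<bar>u t\<bar> + \<bar>u 0\<bar> + \<bar>t * (z * v' z')\<bar>" by linarith
  also have "\<bar>t * (z * v' z')\<bar> = t * (z * \<bar>v' z'\<bar>)" using t z(1) by (simp add: abs_mult)
  also have "\<dots> \<le> t * (t * C)"
    using t z C C0 by (intro mult_left_mono mult_mono) (auto simp: v'_def)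
  also have "\<bar>u t\<bar> + \<bar>u 0\<bar> \<le> 2 * A" using A[of "x + t *\<^sub>R axis i 1"] A[of "x + 0 *\<^sub>R axis i 1"] unfolding u_def by linarith
  finally have "t * \<bar>v 0\<bar> \<le> 2 * A + t * (t * C)" using t by (simp add: abs_mult)
  then show ?thesis using t by (simp add: v_def field_simps)
qed

text \<open>The derivative is expanded in the standard basis. Bounding every coordinate of a vector
  by its norm costs the factor \<open>CARD('n)\<close>.\<close>

lemma smooth_lipschitz:
  fixes h :: "real ^ 'n::finite \<Rightarrow> real"
  assumes h: "smooth h" and A: "\<And>i x. \<bar>iter_partial [i] h x\<bar> \<le> A"
  shows "\<bar>h x - h y\<bar> \<le> real CARD('n) * A * norm (x - y)"
proof -
  obtain h' where h': "\<And>x. (h has_derivative h' x) (at x)"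
  proof -
    have "\<exists>h'. (h has_derivative h') (at x)" for x
      using h[unfolded smooth_def, rule_format, of "[]" x] by (simp add: iter_partial_Nil differentiable_def)
    then show ?thesis using that by metis
  qed
  have "\<bar>h' x v\<bar> \<le> real CARD('n) * A * norm v" for x v
  proof -
    have lin: "linear (h' x)" by (rule has_derivative_linear[OF h'])
    have "h' x v = h' x (\<Sum>i\<in>UNIV. (v $ i) *\<^sub>R axis i 1)"
      using basis_expansion[of v] by (simp only: scalar_mult_eq_scaleR)
    also have "\<dots> = (\<Sum>i\<in>UNIV. v $ i * h' x (axis i 1))"
      by (simp add: linear_sum[OF lin] linear_scale[OF lin])
    also have "\<bar>\<dots>\<bar> \<le> (\<Sum>i\<in>(UNIV::'n set). norm v * A)"
    proof (intro sum_abs[THEN order_trans] sum_mono)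
      fix i :: 'n
      have "\<bar>h' x (axis i 1)\<bar> \<le> A"
        using A[of i x] by (simp add: iter_partial_Cons iter_partial_Nil partial_deriv_eq_derivative[OF h'])
      then show "\<bar>v $ i * h' x (axis i 1)\<bar> \<le> norm v * A"
        unfolding abs_mult by (intro mult_mono component_le_norm_cart) auto
    qed
    finally show ?thesis by (simp add: mult_ac)
  qed
  then have "onorm (h' x) \<le> real CARD('n) * A" for x
    by (intro onorm_le) (simp add: mult_ac)
  then show ?thesis
    using differentiable_bound[of UNIV h h' "real CARD('n) * A" x y] h' by (simp add: has_derivative_at_withinI)
qed

section \<open>Pointwise bounds by tent functions\<close>

text \<open>The tent \<open>\<phi>\<close> of height 1 and radius \<open>r\<close> at
  \<open>x0\<close> has Lipschitz constant \<open>1 / r\<close>, so its integral against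
  \<open>f - g\<close> is at most \<open>2 * w / r\<close>. Freezing \<open>f - g\<close> at
  \<open>x0\<close> changes this integral by at most \<open>L * r\<close> times the integral of
  \<open>\<phi>\<close>, and the latter is at least of order \<open>r ^ d\<close>.\<close>

lemma density_difference_tent_bound:
  fixes f g :: "real ^ 'n::finite \<Rightarrow> real"
  defines "d \<equiv> CARD('n)"
  assumes f: "law_with_density \<mu> f" and g: "law_with_density \<nu> g"
    and q: "1 < q" and w: "wasserstein q \<mu> \<nu> < ennreal w"
    and lip: "\<And>x y. \<bar>(f x - g x) - (f y - g y)\<bar> \<le> L * norm (x - y)" and L: "0 \<le> L"
    and r: "0 < r"
  shows "\<bar>f x0 - g x0\<bar> \<le> L * r + 2 ^ (d + 2) / unit_ball_vol d * (w / r ^ (d + 1))"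
proof -
  have w0: "0 < w" using w by (metis ennreal_less_zero_iff le_less_trans zero_le)
  define \<phi> where "\<phi> x = max 0 (1 - norm (x - x0) / r)" for x
  have \<phi>01: "0 \<le> \<phi> x" "\<phi> x \<le> 1" for x using r by (auto simp: \<phi>_def)
  have \<phi>_lip: "\<bar>\<phi> x - \<phi> y\<bar> \<le> 1 / r * norm (x - y)" for x y
  proof -
    have "\<bar>\<phi> x - \<phi> y\<bar> \<le> \<bar>norm (x - x0) / r - norm (y - x0) / r\<bar>"
      unfolding \<phi>_def by linarith
    also have "\<dots> = \<bar>norm (x - x0) - norm (y - x0)\<bar> / r"
      using r by (simp flip: diff_divide_distrib)
    also have "\<dots> \<le> norm (x - y) / r"
      using r norm_triangle_ineq3[of "x - x0" "y - x0"] by (intro divide_right_mono) auto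
    finally show ?thesis by simp
  qed
  have [measurable]: "\<phi> \<in> borel_measurable borel"
    unfolding \<phi>_def by measurable
  have [measurable]: "f \<in> borel_measurable borel" "g \<in> borel_measurable borel"
    and \<mu>: "\<mu> = density lborel (\<lambda>x. ennreal (f x))" "\<nu> = density lborel (\<lambda>x. ennreal (g x))"
    and f0: "\<And>x. 0 \<le> f x" and g0: "\<And>x. 0 \<le> g x"
    and prob: "prob_space \<mu>" "prob_space \<nu>"
    using f g by (auto simp: law_with_density_def)
  have "integrable \<mu> \<phi>" "integrable \<nu> \<phi>"
    using \<phi>01 prob
    by (auto intro!: finite_measure.integrable_const_bound[where B = 1] prob_space.finite_measure simp: \<mu>)
  then have int: "integrable lborel (\<lambda>x. f x * \<phi> x)" "integrable lborel (\<lambda>x. g x * \<phi> x)"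
    using f0 g0 unfolding \<mu> by (auto simp: integrable_density)
  have "(\<integral>x. \<phi> x \<partial>\<mu>) = (\<integral>x. f x * \<phi> x \<partial>lborel)" "(\<integral>x. \<phi> x \<partial>\<nu>) = (\<integral>x. g x * \<phi> x \<partial>lborel)"
    using f0 g0 unfolding \<mu> by (auto simp: integral_density)
  then have diff: "(\<integral>x. \<phi> x \<partial>\<mu>) - (\<integral>x. \<phi> x \<partial>\<nu>) = (\<integral>x. (f x - g x) * \<phi> x \<partial>lborel)"
    using int by (simp add: left_diff_distrib)
  have "\<bar>(\<integral>x. \<phi> x \<partial>\<mu>) - (\<integral>x. \<phi> x \<partial>\<nu>)\<bar> \<le> 2 * (1 / r) * w"
    using \<phi>01 r by (intro wasserstein_lipschitz_bound[where B = 1, OF _ _ q w \<phi>_lip]) (auto simp: \<mu>)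
  then have dual: "\<bar>\<integral>x. (f x - g x) * \<phi> x \<partial>lborel\<bar> \<le> 2 * w / r" by (simp add: diff)
  have int_h: "integrable lborel (\<lambda>x. (f x - g x) * \<phi> x)"
    using int by (simp add: left_diff_distrib)
  have int_\<phi>: "integrable lborel \<phi>"
  proof (rule Bochner_Integration.integrable_bound)
    show "integrable lborel (indicator (cball x0 r) :: _ \<Rightarrow> real)"
      using emeasure_lborel_cball_finite[of x0 r] by (intro integrable_real_indicator) auto
    show "AE x in lborel. norm (\<phi> x) \<le> norm (indicator (cball x0 r) x :: real)"
      using r by (auto simp: \<phi>_def indicator_def dist_norm norm_minus_commute field_simps)
  qed simp
  define I where "I = (\<integral>x. \<phi> x \<partial>lborel)"
  \<comment> \<open>The tent is at least 1/2 on the ball of half the radius; this yields the power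
    \<open>2 ^ (d + 1)\<close>.\<close>
  have I: "unit_ball_vol d * r ^ d / 2 ^ (d + 1) \<le> I"
  proof -
    have int_i: "integrable lborel (\<lambda>x. indicator (ball x0 (r / 2)) x / (2::real))"
      using emeasure_lborel_ball_finite[of x0 "r / 2"] by (intro integrable_divide integrable_real_indicator) auto
    have "unit_ball_vol d * r ^ d / 2 ^ (d + 1) = measure lborel (ball x0 (r / 2)) / 2"
      using r by (simp add: content_ball d_def power_divide)
    also have "\<dots> = (\<integral>x. indicator (ball x0 (r / 2)) x / 2 \<partial>lborel)"
      by simp
    also have "\<dots> \<le> I"
      unfolding I_def using r \<phi>01
      by (intro integral_mono[OF int_i int_\<phi>])
        (auto simp: indicator_def \<phi>_def dist_norm norm_minus_commute field_simps)
    finally show ?thesis .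
  qed
  have vol: "0 < unit_ball_vol d" by simp
  have I0: "0 < I" by (rule less_le_trans[OF _ I]) (use vol r in simp)
  have "(f x0 - g x0) * I = (\<integral>x. (f x - g x) * \<phi> x \<partial>lborel)
      - (\<integral>x. ((f x - g x) - (f x0 - g x0)) * \<phi> x \<partial>lborel)"
  proof -
    have "(\<integral>x. ((f x - g x) - (f x0 - g x0)) * \<phi> x \<partial>lborel)
        = (\<integral>x. (f x - g x) * \<phi> x - (f x0 - g x0) * \<phi> x \<partial>lborel)"
      by (intro Bochner_Integration.integral_cong) (auto simp: algebra_simps)
    also have "\<dots> = (\<integral>x. (f x - g x) * \<phi> x \<partial>lborel) - (f x0 - g x0) * I"
      unfolding I_def using int_h int_\<phi> by (subst Bochner_Integration.integral_diff) auto
    finally show ?thesis by simp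
  qed
  also have "\<bar>\<dots>\<bar> \<le> 2 * w / r + L * r * I"
  proof -
    have "\<bar>\<integral>x. ((f x - g x) - (f x0 - g x0)) * \<phi> x \<partial>lborel\<bar> \<le> (\<integral>x. L * r * \<phi> x \<partial>lborel)"
    proof (rule order_trans[OF integral_abs_bound integral_mono])
      have "integrable lborel (\<lambda>x. (f x - g x) * \<phi> x - (f x0 - g x0) * \<phi> x)"
        using int_h int_\<phi> by auto
      then show "integrable lborel (\<lambda>x. \<bar>((f x - g x) - (f x0 - g x0)) * \<phi> x\<bar>)"
        by (simp add: left_diff_distrib)
      fix x
      show "\<bar>((f x - g x) - (f x0 - g x0)) * \<phi> x\<bar> \<le> L * r * \<phi> x"
      proof (cases "norm (x - x0) \<le> r")
        case True
        have "\<bar>(f x - g x) - (f x0 - g x0)\<bar> \<le> L * r"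
          using lip[of x x0] mult_left_mono[OF True L] by linarith
        then show ?thesis using \<phi>01(1)[of x] by (simp add: abs_mult mult_right_mono)
      next
        case False
        then have "\<phi> x = 0" using r by (simp add: \<phi>_def field_simps)
        then show ?thesis by simp
      qed
    qed (use int_\<phi> in auto)
    then show ?thesis using dual by (simp add: I_def)
  qed
  finally have "\<bar>f x0 - g x0\<bar> * I \<le> 2 * w / r + L * r * I" using I0 by (simp add: abs_mult)
  then have "\<bar>f x0 - g x0\<bar> \<le> L * r + 2 * w / r / I" using I0 r by (simp add: field_simps)
  also have "2 * w / r / I \<le> 2 * w / r / (unit_ball_vol d * r ^ d / 2 ^ (d + 1))"
    using I vol w0 r I0 by (intro divide_left_mono) auto
  also have "\<dots> = 2 ^ (d + 2) / unit_ball_vol d * (w / r ^ (d + 1))"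
    using vol r by (simp add: field_simps)
  finally show ?thesis by simp
qed

section \<open>Uniform unweighted bounds for all derivatives\<close>

text \<open>An entry is at most the Euclidean norm of the array. Finiteness of the index set
  matters: \<open>L2_set\<close> over an infinite set is 0.\<close>

lemma iter_partial_le_deriv_norm:
  fixes f :: "real ^ 'n::finite \<Rightarrow> 'b::real_normed_vector"
  shows "norm (iter_partial js f x) \<le> deriv_norm (length js) f x"
  unfolding deriv_norm_def
  by (rule member_le_L2_set[of "{ks. length ks = length js}" js "\<lambda>js. norm (iter_partial js f x)"])
    (use finite_lists_length_eq[of "UNIV :: 'n set" "length js"] in auto)

text \<open>The triangle inequality suffices. The maximum with 0 reflects that
  \<open>ennreal\<close> truncates a negative \<open>D\<close>.\<close>

lemma admissible_difference_bound:
  fixes f g :: "real ^ 'n::finite \<Rightarrow> real"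
  assumes "admissible D \<mu> f \<nu> g"
  shows "\<bar>iter_partial js f x - iter_partial js g x\<bar> * (1 + norm x) ^ l \<le> max 0 (D (length js) l)"
proof -
  let ?n = "\<lambda>f. deriv_norm (length js) f x * (1 + norm x) ^ l"
  have n0: "0 \<le> deriv_norm k f x" for k and f :: "real ^ 'n \<Rightarrow> real" and x
    by (simp add: deriv_norm_def L2_set_nonneg)
  have "ennreal (?n f) + ennreal (?n g)
      \<le> sup_norm (\<lambda>x. deriv_norm (length js) f x * (1 + norm x) ^ l)
        + sup_norm (\<lambda>x. deriv_norm (length js) g x * (1 + norm x) ^ l)"
    unfolding sup_norm_def using n0
    by (intro add_mono SUP_upper2[of x]) auto
  also have "\<dots> \<le> ennreal (D (length js) l)"
    using assms by (simp add: admissible_def)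
  finally have "ennreal (?n f + ?n g) \<le> ennreal (D (length js) l)"
    using n0 by (simp flip: ennreal_plus)
  then have "?n f + ?n g \<le> max 0 (D (length js) l)"
    by (metis ennreal_le_iff ennreal_max_0 max.cobounded1)
  moreover have "\<bar>iter_partial js f x - iter_partial js g x\<bar> * (1 + norm x) ^ l \<le> ?n f + ?n g"
    unfolding distrib_right[symmetric]
    using iter_partial_le_deriv_norm[of js f x] iter_partial_le_deriv_norm[of js g x]
    by (intro mult_right_mono) auto
  ultimately show ?thesis by linarith
qed

text \<open>Feeds the suprema \<open>A f g\<close> of all admissible pairs at once into the abstract
  exponent argument, so that \<open>K\<close> is chosen before the laws.\<close>

lemma deriv_difference_wasserstein_bound:
  fixes D :: "nat \<Rightarrow> nat \<Rightarrow> real"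
  assumes q: "1 < q" and \<theta>: "\<theta> < 1"
  shows "\<exists>K\<ge>0. \<forall>(\<mu> :: (real ^ 'n::finite) measure) f \<nu> g w (js :: 'n list) x. admissible D \<mu> f \<nu> g \<longrightarrow>
    wasserstein q \<mu> \<nu> < ennreal w \<longrightarrow> w \<le> 1 \<longrightarrow> length js = k \<longrightarrow>
    \<bar>iter_partial js f x - iter_partial js g x\<bar> \<le> K * w powr \<theta>"
proof -
  \<comment> \<open>A real \<open>Sup\<close> is meaningful only for nonempty sets bounded above;
    \<open>ne\<close> and \<open>bnd\<close> ensure this.\<close>
  define A where "A f g k = Sup {\<bar>iter_partial js f x - iter_partial js g x\<bar> | js x. length js = k}"
    for f g :: "real ^ 'n \<Rightarrow> real" and k
  have ne: "{\<bar>iter_partial js f x - iter_partial js g x\<bar> | js x. length js = k} \<noteq> {}"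
    for f g :: "real ^ 'n \<Rightarrow> real" and k
    using length_replicate[of k undefined] by blast
  have bnd: "\<bar>iter_partial js f x - iter_partial js g x\<bar> \<le> max 0 (D (length js) 0)"
    if "admissible D \<mu> f \<nu> g" for \<mu> \<nu> and f g :: "real ^ 'n \<Rightarrow> real" and js x
    using admissible_difference_bound[OF that, of js x 0] by simp
  have A_upper: "\<bar>iter_partial js f x - iter_partial js g x\<bar> \<le> A f g k"
    if "admissible D \<mu> f \<nu> g" "length js = k" for \<mu> \<nu> and f g :: "real ^ 'n \<Rightarrow> real" and js x k
    unfolding A_def
  proof (rule cSup_upper)
    show "bdd_above {\<bar>iter_partial js f x - iter_partial js g x\<bar> | js x. length js = k}"
      using bnd[OF that(1)] by (intro bdd_aboveI[of _ "max 0 (D k 0)"]) blast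
  qed (use that in blast)
  have A_least: "A f g k \<le> b" if "\<And>js x. length js = k \<Longrightarrow> \<bar>iter_partial js f x - iter_partial js g x\<bar> \<le> b"
    for f g :: "real ^ 'n \<Rightarrow> real" and k b
    unfolding A_def by (rule cSup_least[OF ne]) (use that in auto)
  define S where "S = {(A f g, w) | (\<mu> :: (real ^ 'n) measure) f \<nu> g w.
    admissible D \<mu> f \<nu> g \<and> wasserstein q \<mu> \<nu> < ennreal w \<and> w \<le> 1}"
  define d where "d = CARD('n)"
  \<comment> \<open>Dominates both coefficients: that of the Lipschitz constant and that of the tent
    estimate.\<close>
  define K0 where "K0 = max (real d) (2 ^ (d + 2) / unit_ball_vol d)"
  \<comment> \<open>In \<open>m = d + 1\<close>, the volume of the tent's support accounts for
    \<open>d\<close> and its slope for 1.\<close>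
  have "\<exists>K\<ge>0. \<forall>(a, w)\<in>S. a k \<le> K * w powr \<theta>"
  proof (rule landau_sequence_powr_bound[where B = "\<lambda>k. max 0 (D k 0)" and m = "d + 1"])
    fix a w assume "(a, w) \<in> S"
    then obtain \<mu> :: "(real ^ 'n) measure" and f \<nu> g where adm: "admissible D \<mu> f \<nu> g"
      and W: "wasserstein q \<mu> \<nu> < ennreal w" "w \<le> 1" and a: "a = A f g"
      unfolding S_def by auto
    have w0: "0 < w" using W(1) by (metis ennreal_less_zero_iff le_less_trans zero_le)
    then show "0 < w \<and> w \<le> 1" using W by simp
    have sm: "smooth f" "smooth g" and law: "law_with_density \<mu> f" "law_with_density \<nu> g"
      using adm by (auto simp: admissible_def)
    note h = smooth_diff[OF sm]
    note diff = iter_partial_diff[OF sm]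
    show "a k \<le> max 0 (D k 0)" for k
      unfolding a using bnd[OF adm] by (intro A_least) auto
    have a0: "0 \<le> a k" for k
      unfolding a using A_upper[OF adm, of "replicate k undefined" k 0] by simp
    show "a (Suc k) \<le> 2 * a k / t + t * a (Suc (Suc k))" if t: "0 < t" for k t
      unfolding a
    proof (rule A_least)
      fix js :: "'n list" and x assume "length js = Suc k"
      then obtain i js' where js: "js = i # js'" "length js' = k" by (auto simp: length_Suc_conv)
      show "\<bar>iter_partial js f x - iter_partial js g x\<bar> \<le> 2 * A f g k / t + t * A f g (Suc (Suc k))"
        using smooth_landau[OF h t, of js' "A f g k" i "A f g (Suc (Suc k))" x] A_upper[OF adm] js
        by (simp add: diff)
    qed
    show "a 0 \<le> K0 * (a 1 * r + w / r ^ (d + 1))" if r: "0 < r" for r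
      unfolding a
    proof (rule A_least)
      fix js :: "'n list" and x assume "length js = 0"
      then have js: "js = []" by simp
      have "\<bar>(f x - g x) - (f y - g y)\<bar> \<le> real d * A f g 1 * norm (x - y)" for x y
        unfolding d_def using A_upper[OF adm] by (intro smooth_lipschitz[OF h]) (simp add: diff)
      then have "\<bar>f x - g x\<bar> \<le> real d * A f g 1 * r + 2 ^ (d + 2) / unit_ball_vol d * (w / r ^ (d + 1))"
        using density_difference_tent_bound[OF law q W(1) _ _ r, of "real d * A f g 1" x] a0[of 1]
        by (simp add: d_def a)
      also have "\<dots> \<le> K0 * (A f g 1 * r) + K0 * (w / r ^ (d + 1))"
        unfolding mult.assoc using a0[of 1] r w0
        by (intro add_mono mult_right_mono) (auto simp: K0_def a)
      finally show "\<bar>iter_partial js f x - iter_partial js g x\<bar> \<le> K0 * (A f g 1 * r + w / r ^ (d + 1))"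
        by (simp add: js iter_partial_Nil distrib_left)
    qed
  qed (use \<theta> in \<open>auto simp: K0_def\<close>)
  then obtain K where K: "0 \<le> K" "\<And>a w. (a, w) \<in> S \<Longrightarrow> a k \<le> K * w powr \<theta>" by blast
  show ?thesis
  proof (intro exI[of _ K] conjI allI impI)
    fix \<mu> :: "(real ^ 'n) measure" and f \<nu> g w x and js :: "'n list"
    assume *: "admissible D \<mu> f \<nu> g" "wasserstein q \<mu> \<nu> < ennreal w" "w \<le> 1" "length js = k"
    then have "(A f g, w) \<in> S" unfolding S_def by blast
    then show "\<bar>iter_partial js f x - iter_partial js g x\<bar> \<le> K * w powr \<theta>"
      using A_upper[OF *(1,4), of x] K(2) by fastforce
  qed (rule K(1))
qed

section \<open>Polynomial weights\<close>

text \<open>Interpolation: \<open>?u\<close> is split into \<open>?u powr (1 - \<delta>)\<close>,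
  controlled by the unweighted estimate, and \<open>?u powr \<delta>\<close>, which absorbs the
  weight through the assumed decay of high order \<open>l\<close>.\<close>

lemma weighted_deriv_difference_wasserstein_bound:
  fixes D :: "nat \<Rightarrow> nat \<Rightarrow> real"
  assumes q: "1 < q" and \<epsilon>: "0 < \<epsilon>" "\<epsilon> < 1"
  shows "\<exists>K\<ge>0. \<forall>(\<mu> :: (real ^ 'n::finite) measure) f \<nu> g w (js :: 'n list) x. admissible D \<mu> f \<nu> g \<longrightarrow>
    wasserstein q \<mu> \<nu> < ennreal w \<longrightarrow> length js = k \<longrightarrow>
    \<bar>iter_partial js f x - iter_partial js g x\<bar> * (1 + norm x) ^ n \<le> K * w powr (1 - \<epsilon>)"
proof -
  \<comment> \<open>Any value strictly between 0 and \<open>\<epsilon>\<close> leaves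
    \<open>\<theta>\<close> below 1, where \<open>\<theta>\<close> is the unweighted exponent that
    becomes \<open>1 - \<epsilon>\<close> after raising to the power
    \<open>1 - \<delta>\<close>.\<close>
  define \<delta> where "\<delta> = \<epsilon> / 2"
  have \<delta>: "0 < \<delta>" "\<delta> < 1" "\<epsilon> = 2 * \<delta>" using \<epsilon> by (auto simp: \<delta>_def)
  define \<theta> where "\<theta> = (1 - \<epsilon>) / (1 - \<delta>)"
  have \<theta>: "\<theta> < 1" "\<theta> * (1 - \<delta>) = 1 - \<epsilon>" using \<delta> by (auto simp: \<theta>_def divide_less_eq)
  obtain K where K: "0 \<le> K" "\<And>(\<mu> :: (real ^ 'n) measure) f \<nu> g w (js :: 'n list) x. admissible D \<mu> f \<nu> g \<Longrightarrow>
    wasserstein q \<mu> \<nu> < ennreal w \<Longrightarrow> w \<le> 1 \<Longrightarrow> length js = k \<Longrightarrow>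
    \<bar>iter_partial js f x - iter_partial js g x\<bar> \<le> K * w powr \<theta>"
    using deriv_difference_wasserstein_bound[OF q \<theta>(1), of D k] by blast
  define l where "l = nat \<lceil>n / \<delta>\<rceil>"
  have l: "n \<le> l * \<delta>"
  proof -
    have "n / \<delta> \<le> l" unfolding l_def by linarith
    then show ?thesis using \<delta> by (simp add: field_simps)
  qed
  define E where "E = max 0 (D k l)"
  show ?thesis
  proof (intro exI[of _ "max (max 0 (D k n)) (K powr (1 - \<delta>) * E powr \<delta>)"] conjI allI impI)
    fix \<mu> :: "(real ^ 'n) measure" and f \<nu> g w x and js :: "'n list"
    assume adm: "admissible D \<mu> f \<nu> g" and W: "wasserstein q \<mu> \<nu> < ennreal w" and js: "length js = k"
    let ?u = "\<bar>iter_partial js f x - iter_partial js g x\<bar>"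
    let ?v = "1 + norm x"
    have w0: "0 < w" using W by (metis ennreal_less_zero_iff le_less_trans zero_le)
    show "?u * ?v ^ n \<le> max (max 0 (D k n)) (K powr (1 - \<delta>) * E powr \<delta>) * w powr (1 - \<epsilon>)"
    proof (cases "w \<le> 1")
      case True
      have "?v ^ n = ?v powr n" by (simp add: powr_realpow add_pos_nonneg)
      also have "\<dots> \<le> ?v powr (l * \<delta>)" using l by (intro powr_mono) auto
      also have "\<dots> = (?v ^ l) powr \<delta>" by (simp add: powr_powr add_pos_nonneg flip: powr_realpow)
      finally have "?u * ?v ^ n \<le> ?u * (?v ^ l) powr \<delta>" by (rule mult_left_mono) simp
      also have "?u * (?v ^ l) powr \<delta> = (?u powr (1 - \<delta>) * ?u powr \<delta>) * (?v ^ l) powr \<delta>"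
        by (simp flip: powr_add)
      also have "\<dots> = ?u powr (1 - \<delta>) * (?u * ?v ^ l) powr \<delta>"
        by (simp add: powr_mult)
      also have "\<dots> \<le> (K * w powr \<theta>) powr (1 - \<delta>) * E powr \<delta>"
        using K(2)[OF adm W True js, of x] admissible_difference_bound[OF adm, of js x l] \<delta> js
        by (intro mult_mono powr_mono2) (auto simp: E_def)
      also have "\<dots> = K powr (1 - \<delta>) * E powr \<delta> * w powr (1 - \<epsilon>)"
        using K(1) by (simp add: powr_mult powr_powr \<theta>(2))
      also have "\<dots> \<le> max (max 0 (D k n)) (K powr (1 - \<delta>) * E powr \<delta>) * w powr (1 - \<epsilon>)"
        by (intro mult_right_mono) auto
      finally show ?thesis .
    next
      case False
      \<comment> \<open>For \<open>w > 1\<close> the assumed decay suffices, as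
        \<open>w powr (1 - \<epsilon>)\<close> is at least 1.\<close>
      have "?u * ?v ^ n \<le> max 0 (D k n)"
        using admissible_difference_bound[OF adm, of js x n] js by simp
      also have "\<dots> \<le> max 0 (D k n) * w powr (1 - \<epsilon>)"
        using False \<epsilon> ge_one_powr_ge_zero[of w "1 - \<epsilon>"] by (simp add: mult_le_cancel_left1)
      also have "\<dots> \<le> max (max 0 (D k n)) (K powr (1 - \<delta>) * E powr \<delta>) * w powr (1 - \<epsilon>)"
        by (intro mult_right_mono) auto
      finally show ?thesis .
    qed
  qed simp
qed

text \<open>The estimates hold for all reals above the Wasserstein distance, which may be 0 or infinite.\<close>

lemma le_ennpowr_of_greater:
  assumes K: "0 < K" and a: "0 < a"
    and le: "\<And>w. W < ennreal w \<Longrightarrow> y \<le> K * w powr a"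
  shows "ennreal y \<le> ennreal K * ennpowr W a"
proof (cases W)
  case (real v)
  \<comment> \<open>Positivity of \<open>a\<close> gives continuity even at
    \<open>v = 0\<close>.\<close>
  have "((\<lambda>w. K * w powr a) \<longlongrightarrow> K * v powr a) (at_right v)"
    using real a by (intro tendsto_intros tendsto_powr') (auto simp: eventually_at_filter)
  moreover have "\<forall>\<^sub>F w in at_right v. y \<le> K * w powr a"
    using real by (auto simp: eventually_at_filter ennreal_less_iff intro!: always_eventually le)
  ultimately have "y \<le> K * v powr a" by (intro tendsto_lowerbound) auto
  then show ?thesis using real K by (simp add: ennpowr_def ennreal_leI flip: ennreal_mult)
next
  \<comment> \<open>No real \<open>w\<close> exceeds an infinite \<open>W\<close>, but
    \<open>0 < K\<close> makes the right-hand side infinite.\<close>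
  case top
  then show ?thesis using K by (simp add: ennpowr_def ennreal_mult_top)
qed

section \<open>Total variation and integrability of the weight\<close>

text \<open>On each block \<open>B\<close> of a partition the two measures differ by at most the
  integral of \<open>\<bar>f x - g x\<bar>\<close> over \<open>B\<close>; summing over the blocks
  bounds every term of the supremum. An upper bound is enough for estimating the weighted
  distance.\<close>

lemma tv_measure_le_density:
  assumes f: "law_with_density \<mu> f" and g: "law_with_density \<nu> g"
  shows "tv_measure \<mu> \<nu> \<le> density lborel (\<lambda>x. ennreal \<bar>f x - g x\<bar>)"
proof -
  have [measurable]: "f \<in> borel_measurable borel" "g \<in> borel_measurable borel"
    and \<mu>: "\<mu> = density lborel (\<lambda>x. ennreal (f x))" "\<nu> = density lborel (\<lambda>x. ennreal (g x))"
    and f0: "\<And>x. 0 \<le> f x" and g0: "\<And>x. 0 \<le> g x"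
    using f g by (auto simp: law_with_density_def)
  interpret M: prob_space \<mu> using f unfolding law_with_density_def by blast
  interpret N: prob_space \<nu> using g unfolding law_with_density_def by blast
  let ?h = "density lborel (\<lambda>x. ennreal \<bar>f x - g x\<bar>)"
  have one: "ennreal \<bar>measure \<mu> B - measure \<nu> B\<bar> \<le> emeasure ?h B" if B: "B \<in> sets borel" for B
  proof -
    have "emeasure \<mu> B \<le> emeasure \<nu> B + emeasure ?h B"
      unfolding \<mu> using B f0 g0
      by (simp add: emeasure_density flip: nn_integral_add)
        (auto intro!: nn_integral_mono simp: indicator_def simp flip: ennreal_plus)
    moreover have "emeasure \<nu> B \<le> emeasure \<mu> B + emeasure ?h B"
      unfolding \<mu> using B f0 g0
      by (simp add: emeasure_density flip: nn_integral_add)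
        (auto intro!: nn_integral_mono simp: indicator_def simp flip: ennreal_plus)
    ultimately show ?thesis
      unfolding M.emeasure_eq_measure N.emeasure_eq_measure
      by (cases "emeasure ?h B") (auto simp flip: ennreal_plus)
  qed
  have sets: "sets (tv_measure \<mu> \<nu>) = sets borel"
    by (simp add: tv_measure_def \<mu> sigma_algebra.sets_measure_of_eq[OF sets.sigma_algebra_axioms, of borel, simplified])
  have "emeasure (tv_measure \<mu> \<nu>) X \<le> emeasure ?h X" for X
  proof (cases "X \<in> sets borel")
    case True
    define \<tau> where "\<tau> A = (SUP P \<in> {P. finite P \<and> P \<subseteq> sets \<mu> \<and> partition_on A P}.
            \<Sum>B\<in>P. ennreal \<bar>measure \<mu> B - measure \<nu> B\<bar>)" for A
    \<comment> \<open>\<open>measure_of\<close> yields the zero measure if \<open>\<tau>\<close> is not countably additive, so the bound holds either way.\<close>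
    have "emeasure (tv_measure \<mu> \<nu>) X \<le> \<tau> X"
      unfolding tv_measure_def \<tau>_def[abs_def, symmetric] emeasure_measure_of_conv by simp
    also have "\<dots> \<le> emeasure ?h X"
      unfolding \<tau>_def
    proof (rule SUP_least, safe)
      fix P assume P: "finite P" "P \<subseteq> sets \<mu>" "partition_on X P"
      then have "(\<Sum>B\<in>P. ennreal \<bar>measure \<mu> B - measure \<nu> B\<bar>) \<le> (\<Sum>B\<in>P. emeasure ?h B)"
        by (intro sum_mono one) (auto simp: \<mu>)
      also have "\<dots> = emeasure ?h (\<Union>P)"
        using P sum_emeasure[of "\<lambda>B. B" P ?h]
        by (auto simp: \<mu> partition_on_def disjoint_family_on_disjoint_image disjoint_def disjoint_family_on_def)
      finally show "(\<Sum>B\<in>P. ennreal \<bar>measure \<mu> B - measure \<nu> B\<bar>) \<le> emeasure ?h X"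
        using P(3) by (simp add: partition_on_def)
    qed
    finally show ?thesis .
  qed (simp add: emeasure_notin_sets sets)
  then show ?thesis
    by (simp add: le_measure sets)
qed

text \<open>At \<open>x\<close>, the integrand is dominated by the series term whose index is the
  integer part of \<open>norm x\<close>. The volume of the ball of radius \<open>k + 1\<close>
  cancels all but two of the \<open>DIM('a) + 2\<close> powers, leaving the convergent series of
  inverse squares.\<close>

lemma nn_integral_inverse_power_finite:
  "(\<integral>\<^sup>+x. ennreal (1 / (1 + norm x) ^ (DIM('a) + 2)) \<partial>(lborel :: 'a::euclidean_space measure)) < \<infinity>"
proof -
  let ?d = "DIM('a)"
  have term_le: "F k \<le> (\<Sum>k. F k)" for F :: "nat \<Rightarrow> ennreal" and k
    using sum_le_suminf[OF summableI, of "{k}" F] by simp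
  have "ennreal (1 / (1 + norm x) ^ (?d + 2))
      \<le> (\<Sum>k. ennreal (1 / (real k + 1) ^ (?d + 2)) * indicator (ball 0 (real k + 1)) x)" for x :: 'a
  proof -
    define k where "k = nat \<lfloor>norm x\<rfloor>"
    have k: "real k \<le> norm x" "norm x < real k + 1" unfolding k_def using norm_ge_zero[of x] by linarith+
    have "1 / (1 + norm x) ^ (?d + 2) \<le> 1 / (real k + 1) ^ (?d + 2)"
      using k by (intro divide_left_mono power_mono) (auto intro!: mult_pos_pos add_pos_nonneg)
    then have "ennreal (1 / (1 + norm x) ^ (?d + 2))
        \<le> ennreal (1 / (real k + 1) ^ (?d + 2)) * indicator (ball 0 (real k + 1)) x"
      using k by (simp add: ennreal_leI)
    also have "\<dots> \<le> (\<Sum>k. ennreal (1 / (real k + 1) ^ (?d + 2)) * indicator (ball 0 (real k + 1)) x)"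
      by (rule term_le)
    finally show ?thesis .
  qed
  then have "(\<integral>\<^sup>+x. ennreal (1 / (1 + norm x) ^ (?d + 2)) \<partial>(lborel :: 'a measure))
      \<le> (\<integral>\<^sup>+x. (\<Sum>k. ennreal (1 / (real k + 1) ^ (?d + 2)) * indicator (ball 0 (real k + 1)) x) \<partial>(lborel :: 'a measure))"
    by (intro nn_integral_mono) auto
  also have "\<dots> = (\<Sum>k. ennreal (1 / (real k + 1) ^ (?d + 2)) * emeasure lborel (ball (0::'a) (real k + 1)))"
  proof (subst nn_integral_suminf)
    show "(\<lambda>x. ennreal (1 / (real k + 1) ^ (?d + 2)) * indicator (ball 0 (real k + 1)) x)
        \<in> borel_measurable (lborel :: 'a measure)" for k
      by (intro borel_measurable_times_ennreal borel_measurable_indicator) auto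
  qed (intro suminf_cong nn_integral_cmult_indicator, simp)
  also have "\<dots> = (\<Sum>k. ennreal (unit_ball_vol ?d * (1 / (real (Suc k)) ^ 2)))"
  proof (rule suminf_cong)
    fix k :: nat
    have "ennreal (1 / (real k + 1) ^ (?d + 2)) * emeasure lborel (ball (0::'a) (real k + 1))
        = ennreal (1 / (real k + 1) ^ (?d + 2) * (unit_ball_vol ?d * (real k + 1) ^ ?d))"
      by (subst emeasure_ball, simp, subst ennreal_mult) auto
    also have "1 / (real k + 1) ^ (?d + 2) * (unit_ball_vol ?d * (real k + 1) ^ ?d)
        = unit_ball_vol ?d * (1 / real (Suc k) ^ 2)"
      by (simp add: power_add add.commute power2_eq_square)
    finally show "ennreal (1 / (real k + 1) ^ (?d + 2)) * emeasure lborel (ball (0::'a) (real k + 1))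
        = ennreal (unit_ball_vol ?d * (1 / real (Suc k) ^ 2))" .
  qed
  also have "\<dots> < \<infinity>"
  proof -
    have "summable (\<lambda>k. unit_ball_vol ?d * (1 / real (Suc k) ^ 2))"
      using inverse_power_summable[of 2, where 'a = real]
      by (intro summable_mult) (subst summable_Suc_iff, simp add: inverse_eq_divide)
    then show ?thesis
      by (subst suminf_ennreal2) (auto simp: less_top)
  qed
  finally show ?thesis .
qed

lemma weight_le_power:
  assumes "0 \<le> p" "p \<le> real n" "0 \<le> r"
  shows "1 + r powr p \<le> 2 * (1 + r) ^ n"
proof -
  have "r powr p \<le> (1 + r) powr p" using assms by (intro powr_mono2) auto
  also have "\<dots> \<le> (1 + r) powr real n" using assms by (intro powr_mono) auto
  also have "\<dots> = (1 + r) ^ n" using assms by (simp add: powr_realpow)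
  finally have "r powr p \<le> (1 + r) ^ n" .
  moreover have "1 \<le> (1 + r) ^ n" using assms by (intro one_le_power) auto
  ultimately show ?thesis by linarith
qed

text \<open>Finiteness of the index type makes \<open>\<alpha>\<close> a multiset, so the choice in
  \<open>multi_partial\<close> succeeds. The chosen list does not depend on the function and thus
  serves both densities.\<close>

lemma multi_partial_iter_partial:
  fixes \<alpha> :: "'n::finite \<Rightarrow> nat"
  shows "\<exists>js. length js = (\<Sum>i\<in>UNIV. \<alpha> i) \<and>
    (\<forall>f :: real ^ 'n \<Rightarrow> 'b::real_normed_vector. multi_partial \<alpha> f = iter_partial js f)"
proof -
  have "\<exists>js. \<forall>i. count_list js i = \<alpha> i"
  proof -
    obtain js where "mset js = Abs_multiset \<alpha>" using ex_mset by blast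
    then have "count_list js i = \<alpha> i" for i
      by (metis count_mset count_Abs_multiset finite)
    then show ?thesis by blast
  qed
  then have js: "\<forall>i. count_list (SOME js. \<forall>i. count_list js i = \<alpha> i) i = \<alpha> i"
    by (rule someI_ex)
  have "length (SOME js. \<forall>i. count_list js i = \<alpha> i) = (\<Sum>i\<in>UNIV. \<alpha> i)"
    unfolding sum_count_set[OF subset_UNIV finite, symmetric] using js by (intro sum.cong) auto
  then show ?thesis unfolding multi_partial_def by blast
qed

section \<open>The two estimates\<close>

text \<open>Common source of both claims: the spare power \<open>n\<close> of the weight buys
  integrability for the first and is 0 for the second.\<close>

lemma weighted_sup_difference_bound:
  fixes D :: "nat \<Rightarrow> nat \<Rightarrow> real"
  assumes q: "1 < q" and p: "0 \<le> p" and \<epsilon>: "0 < \<epsilon>" "\<epsilon> < 1"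
  shows "\<exists>K\<ge>0. \<forall>(\<mu> :: (real ^ 'n::finite) measure) f \<nu> g (js :: 'n list) x. admissible D \<mu> f \<nu> g \<longrightarrow>
    length js = k \<longrightarrow>
    ennreal (\<bar>iter_partial js f x - iter_partial js g x\<bar> * (1 + norm x powr p) * (1 + norm x) ^ n)
      \<le> ennreal K * ennpowr (wasserstein q \<mu> \<nu>) (1 - \<epsilon>)"
proof -
  define N where "N = nat \<lceil>p\<rceil>"
  have N: "p \<le> real N" unfolding N_def by linarith
  obtain K where K: "0 \<le> K" "\<And>(\<mu> :: (real ^ 'n) measure) f \<nu> g w (js :: 'n list) x. admissible D \<mu> f \<nu> g \<Longrightarrow>
    wasserstein q \<mu> \<nu> < ennreal w \<Longrightarrow> length js = k \<Longrightarrow>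
    \<bar>iter_partial js f x - iter_partial js g x\<bar> * (1 + norm x) ^ (N + n) \<le> K * w powr (1 - \<epsilon>)"
    using weighted_deriv_difference_wasserstein_bound[OF q \<epsilon>, of D k "N + n"] by blast
  show ?thesis
  \<comment> \<open>The factor 2 comes from \<open>weight_le_power\<close>. The summand 1 keeps the
    constant positive, since 0 times an infinite distance would be 0.\<close>
  proof (intro exI[of _ "2 * K + 1"] conjI allI impI le_ennpowr_of_greater)
    fix \<mu> :: "(real ^ 'n) measure" and f \<nu> g w x and js :: "'n list"
    assume *: "admissible D \<mu> f \<nu> g" "length js = k" "wasserstein q \<mu> \<nu> < ennreal w"
    let ?u = "\<bar>iter_partial js f x - iter_partial js g x\<bar>"
    have "?u * (1 + norm x powr p) * (1 + norm x) ^ n \<le> ?u * (2 * (1 + norm x) ^ N) * (1 + norm x) ^ n"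
      using p N by (intro mult_right_mono mult_left_mono weight_le_power) auto
    also have "\<dots> = 2 * (?u * (1 + norm x) ^ (N + n))" by (simp add: power_add)
    also have "\<dots> \<le> 2 * (K * w powr (1 - \<epsilon>))" using K(2)[OF *(1,3,2), of x] by simp
    also have "\<dots> \<le> (2 * K + 1) * w powr (1 - \<epsilon>)" by (simp add: algebra_simps)
    finally show "?u * (1 + norm x powr p) * (1 + norm x) ^ n \<le> (2 * K + 1) * w powr (1 - \<epsilon>)" .
  qed (use K(1) \<epsilon> in auto)
qed

theorem lemma1:
  fixes D :: "nat \<Rightarrow> nat \<Rightarrow> real"
  shows "(\<forall>q p \<epsilon>. 1 < q \<and> 1 \<le> p \<and> 0 < \<epsilon> \<and> \<epsilon> < 1 \<longrightarrow>
           (\<exists>C\<ge>0. \<forall>(\<mu> :: (real ^ 'n::finite) measure) f \<nu> g. admissible D \<mu> f \<nu> g \<longrightarrow>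
              weighted_tv p \<mu> \<nu> \<le> ennreal C * ennpowr (wasserstein q \<mu> \<nu>) (1 - \<epsilon>)))
       \<and> (\<forall>q p \<epsilon> m. 1 < q \<and> 1 \<le> p \<and> 0 < \<epsilon> \<and> \<epsilon> < 1 \<longrightarrow>
           (\<exists>C'\<ge>0. \<forall>\<alpha> :: 'n \<Rightarrow> nat. (\<Sum>i\<in>UNIV. \<alpha> i) = m \<longrightarrow>
             (\<forall>(\<mu> :: (real ^ 'n) measure) f \<nu> g. admissible D \<mu> f \<nu> g \<longrightarrow>
                sup_norm (\<lambda>x. (multi_partial \<alpha> f x - multi_partial \<alpha> g x) * (1 + norm x powr p))
                  \<le> ennreal C' * ennpowr (wasserstein q \<mu> \<nu>) (1 - \<epsilon>))))"
proof (intro conjI allI impI)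
  fix q p \<epsilon> :: real
  assume "1 < q \<and> 1 \<le> p \<and> 0 < \<epsilon> \<and> \<epsilon> < 1"
  then have q: "1 < q" and p: "0 \<le> p" and \<epsilon>: "0 < \<epsilon>" "\<epsilon> < 1" by auto
  \<comment> \<open>The exponent for which the inverse power of \<open>1 + norm x\<close> is
    integrable by \<open>nn_integral_inverse_power_finite\<close>.\<close>
  define n where "n = DIM(real ^ 'n) + 2"
  obtain K where K: "0 \<le> K" "\<And>(\<mu> :: (real ^ 'n) measure) f \<nu> g (js :: 'n list) x. admissible D \<mu> f \<nu> g \<Longrightarrow>
    length js = 0 \<Longrightarrow>
    ennreal (\<bar>iter_partial js f x - iter_partial js g x\<bar> * (1 + norm x powr p) * (1 + norm x) ^ n)
      \<le> ennreal K * ennpowr (wasserstein q \<mu> \<nu>) (1 - \<epsilon>)"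
    using weighted_sup_difference_bound[OF q p \<epsilon>, of D 0 n] by blast
  define J where "J = (\<integral>\<^sup>+x. ennreal (1 / (1 + norm x) ^ n) \<partial>(lborel :: (real ^ 'n) measure))"
  have J: "J < \<infinity>" unfolding J_def n_def by (rule nn_integral_inverse_power_finite)
  show "\<exists>C\<ge>0. \<forall>(\<mu> :: (real ^ 'n::finite) measure) f \<nu> g. admissible D \<mu> f \<nu> g \<longrightarrow>
              weighted_tv p \<mu> \<nu> \<le> ennreal C * ennpowr (wasserstein q \<mu> \<nu>) (1 - \<epsilon>)"
  proof (intro exI[of _ "K * enn2real J"] conjI allI impI)
    fix \<mu> :: "(real ^ 'n) measure" and f \<nu> g
    assume adm: "admissible D \<mu> f \<nu> g"
    then have law: "law_with_density \<mu> f" "law_with_density \<nu> g" by (auto simp: admissible_def)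
    then have [measurable]: "f \<in> borel_measurable borel" "g \<in> borel_measurable borel"
      and \<mu>: "\<mu> = density lborel (\<lambda>x. ennreal (f x))"
      by (auto simp: law_with_density_def)
    define R where "R = ennreal K * ennpowr (wasserstein q \<mu> \<nu>) (1 - \<epsilon>)"
    have "weighted_tv p \<mu> \<nu> \<le> (\<integral>\<^sup>+x. ennreal (1 + norm x powr p) \<partial>density lborel (\<lambda>x. ennreal \<bar>f x - g x\<bar>))"
      unfolding weighted_tv_def
      by (rule nn_integral_mono_measure[OF _ tv_measure_le_density[OF law]])
        (simp add: tv_measure_def \<mu> sigma_algebra.sets_measure_of_eq[OF sets.sigma_algebra_axioms, of borel, simplified])
    also have "\<dots> = (\<integral>\<^sup>+x. ennreal \<bar>f x - g x\<bar> * ennreal (1 + norm x powr p) \<partial>lborel)"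
      by (rule nn_integral_density) auto
    also have "\<dots> \<le> (\<integral>\<^sup>+x. R * ennreal (1 / (1 + norm x) ^ n) \<partial>(lborel :: (real ^ 'n) measure))"
    proof (rule nn_integral_mono)
      fix x :: "real ^ 'n"
      have nz: "1 + norm x \<noteq> 0" using norm_ge_zero[of x] by linarith
      \<comment> \<open>Multiplying and dividing by the spare power separates a uniform bound from
        an integrable factor.\<close>
      have "ennreal \<bar>f x - g x\<bar> * ennreal (1 + norm x powr p)
          = ennreal (\<bar>f x - g x\<bar> * (1 + norm x powr p) * (1 + norm x) ^ n * (1 / (1 + norm x) ^ n))"
        using nz by (subst ennreal_mult[symmetric]) auto
      also have "\<dots> = ennreal (\<bar>f x - g x\<bar> * (1 + norm x powr p) * (1 + norm x) ^ n) * ennreal (1 / (1 + norm x) ^ n)"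
        by (rule ennreal_mult) auto
      also have "\<dots> \<le> R * ennreal (1 / (1 + norm x) ^ n)"
        using K(2)[OF adm, of "[]" x] by (intro mult_right_mono) (auto simp: R_def iter_partial_Nil)
      finally show "ennreal \<bar>f x - g x\<bar> * ennreal (1 + norm x powr p) \<le> R * ennreal (1 / (1 + norm x) ^ n)" .
    qed
    also have "\<dots> = R * J"
      unfolding J_def by (rule nn_integral_cmult) auto
    also have "J = ennreal (enn2real J)" using J by (simp add: ennreal_enn2real)
    also have "R * ennreal (enn2real J) = ennreal (K * enn2real J) * ennpowr (wasserstein q \<mu> \<nu>) (1 - \<epsilon>)"
      using K(1) by (simp add: R_def ennreal_mult mult_ac)
    finally show "weighted_tv p \<mu> \<nu> \<le> ennreal (K * enn2real J) * ennpowr (wasserstein q \<mu> \<nu>) (1 - \<epsilon>)" .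
  qed (use K(1) in simp)
next
  fix q p \<epsilon> :: real and m :: nat
  assume "1 < q \<and> 1 \<le> p \<and> 0 < \<epsilon> \<and> \<epsilon> < 1"
  then have q: "1 < q" and p: "0 \<le> p" and \<epsilon>: "0 < \<epsilon>" "\<epsilon> < 1" by auto
  obtain K where K: "0 \<le> K" "\<And>(\<mu> :: (real ^ 'n) measure) f \<nu> g (js :: 'n list) x. admissible D \<mu> f \<nu> g \<Longrightarrow>
    length js = m \<Longrightarrow>
    ennreal (\<bar>iter_partial js f x - iter_partial js g x\<bar> * (1 + norm x powr p) * (1 + norm x) ^ 0)
      \<le> ennreal K * ennpowr (wasserstein q \<mu> \<nu>) (1 - \<epsilon>)"
    using weighted_sup_difference_bound[OF q p \<epsilon>, of D m 0] by blast
  show "\<exists>C'\<ge>0. \<forall>\<alpha> :: 'n \<Rightarrow> nat. (\<Sum>i\<in>UNIV. \<alpha> i) = m \<longrightarrow>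
             (\<forall>(\<mu> :: (real ^ 'n) measure) f \<nu> g. admissible D \<mu> f \<nu> g \<longrightarrow>
                sup_norm (\<lambda>x. (multi_partial \<alpha> f x - multi_partial \<alpha> g x) * (1 + norm x powr p))
                  \<le> ennreal C' * ennpowr (wasserstein q \<mu> \<nu>) (1 - \<epsilon>))"
  \<comment> \<open>\<open>K\<close> serves all lists of length \<open>m\<close>, hence all
    multiindices of this order.\<close>
  proof (intro exI[of _ K] conjI allI impI)
    fix \<alpha> :: "'n \<Rightarrow> nat" and \<mu> :: "(real ^ 'n) measure" and f \<nu> g
    assume \<alpha>: "(\<Sum>i\<in>UNIV. \<alpha> i) = m" and adm: "admissible D \<mu> f \<nu> g"
    obtain js where js: "length js = (\<Sum>i\<in>UNIV. \<alpha> i)"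
      "\<And>f :: real ^ 'n \<Rightarrow> real. multi_partial \<alpha> f = iter_partial js f"
      using multi_partial_iter_partial[of \<alpha>, where 'b = real] by blast
    show "sup_norm (\<lambda>x. (multi_partial \<alpha> f x - multi_partial \<alpha> g x) * (1 + norm x powr p))
        \<le> ennreal K * ennpowr (wasserstein q \<mu> \<nu>) (1 - \<epsilon>)"
      unfolding sup_norm_def
      by (rule SUP_least) (use K(2)[OF adm, of js] js \<alpha> in \<open>simp add: abs_mult\<close>)
  qed (rule K(1))
qed

end
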